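(* Let $T$ be a caterpillar. Then $\chi_p(T\odot K_1)\le 7$.
   Context: All graphs are finite, simple and connected. For a graph $G$, $d_G(u,v)$ is the length of a shortest $u$--$v$ path in $G$. A packing coloring of $G$ with $k$ colors is a map $c:V(G)\to\{1,2,\dots,k\}$ such that for every $i\in\{1,\dots,k\}$, any two distinct vertices $u,v$ with $c(u)=c(v)=i$ satisfy $d_G(u,v)>i$. The packing chromatic number $\chi_p(G)$ is the minimum $k$ for which $G$ has such a coloring. A caterpillar is a tree in which all vertices of degree at least two lie on a single path (the central path). The corona $G\odot K_1$ is the graph obtained from $G$ by attaching a single new pendant vertex to each vertex of $G$. *)

theory Defs
  imports "Graph_Theory.Graph_Theory"
begin

text \<open>
  Finite simple graphs are the symmetric loop-free finite digraphs of \<^locale>\<open>pair_graph\<close>: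
  an undirected edge is the pair of arcs \<open>(u, v)\<close> and \<open>(v, u)\<close>.
  In such a digraph \<open>u, v, u\<close> is a cycle in the sense of \<^const>\<open>pre_digraph.cycle\<close>, so that
  \<^const>\<open>tree\<close> is not the undirected notion. The cycles of the undirected graph are
  those of length at least three.
\<close>

definition undirected_tree :: "'a pair_pre_digraph \<Rightarrow> bool" where
  "undirected_tree G \<longleftrightarrow>
     pair_graph G \<and> Digraph_Component.connected (with_proj G) \<and>
     \<not> (\<exists>p. pre_digraph.cycle (with_proj G) p \<and> 3 \<le> length p)"

text \<open>In a symmetric digraph without parallel arcs, \<^const>\<open>out_degree\<close> is the undirected degree.\<close>

definition caterpillar :: "'a pair_pre_digraph \<Rightarrow> bool" where
  "caterpillar G \<longleftrightarrow>
     undirected_tree G \<and>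
     (\<exists>p. vpath p (with_proj G) \<and>
          {v \<in> pverts G. 2 \<le> out_degree (with_proj G) v} \<subseteq> set p)"

text \<open>The pendant vertex attached to \<open>Inl v\<close> is \<open>Inr v\<close>.\<close>

definition corona_K1 :: "'a pair_pre_digraph \<Rightarrow> ('a + 'a) pair_pre_digraph" where
  "corona_K1 G =
     \<lparr> pverts = Inl ` pverts G \<union> Inr ` pverts G,
       parcs = {(Inl u, Inl v) | u v. (u, v) \<in> parcs G} \<union>
               {(Inl v, Inr v) | v. v \<in> pverts G} \<union>
               {(Inr v, Inl v) | v. v \<in> pverts G} \<rparr>"

definition graph_dist :: "'a pair_pre_digraph \<Rightarrow> 'a \<Rightarrow> 'a \<Rightarrow> ereal" where
  "graph_dist G u v = wf_digraph.\<mu> (with_proj G) (\<lambda>_. 1) u v"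

definition packing_coloring :: "'a pair_pre_digraph \<Rightarrow> nat \<Rightarrow> ('a \<Rightarrow> nat) \<Rightarrow> bool" where
  "packing_coloring G k c \<longleftrightarrow>
     c \<in> pverts G \<rightarrow> {1..k} \<and>
     (\<forall>i\<in>{1..k}. \<forall>u\<in>pverts G. \<forall>v\<in>pverts G.
        u \<noteq> v \<and> c u = i \<and> c v = i \<longrightarrow> graph_dist G u v > ereal (real i))"

definition packing_chromatic_number :: "'a pair_pre_digraph \<Rightarrow> nat" where
  "packing_chromatic_number G = (LEAST k. \<exists>c. packing_coloring G k c)"

lemma (in pair_graph) connected_iff_strongly_connected:
  "Digraph_Component.connected (with_proj G) \<longleftrightarrow> strongly_connected (with_proj G)"
  using reachable_mk_symmetric_eq[OF sym_arcs]
  by (simp add: connected_def strongly_connected_def mk_symmetric_def)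

lemma graph_dist_shortest_path:
  assumes "pair_graph G" "Digraph_Component.connected (with_proj G)"
    and "u \<in> pverts G" "v \<in> pverts G"
  obtains p where "pre_digraph.apath (with_proj G) u p v"
    and "graph_dist G u v = ereal (real (length p))"
    and "\<And>q. pre_digraph.awalk (with_proj G) u q v \<Longrightarrow> length p \<le> length q"
proof -
  interpret pair_graph G by fact
  have cost: "awalk_cost (\<lambda>_. 1) p = real (length p)" for p :: "('a \<times> 'a) list"
    by (induct p) auto
  have "u \<rightarrow>\<^sup>*\<^bsub>with_proj G\<^esub> v"
    using assms(2-4) by (auto simp: connected_iff_strongly_connected strongly_connected_def)
  then obtain p where p: "apath u p v" "\<mu> (\<lambda>_. 1) u v = ereal (awalk_cost (\<lambda>_. 1) p)"
    using min_cost_awalk[of u v "\<lambda>_. 1"] by auto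
  show thesis
  proof (rule that[of p])
    show "graph_dist G u v = ereal (real (length p))"
      using p by (simp add: graph_dist_def cost)
    show "length p \<le> length q" if "awalk u q v" for q
      using min_cost_le_walk_cost[OF that, of "\<lambda>_. 1"] p(2) by (simp add: cost)
  qed (use p in simp)
qed

lemma pair_graph_corona_K1:
  assumes "pair_graph G"
  shows "pair_graph (corona_K1 G)"
proof -
  interpret pair_graph G by fact
  have fin: "finite (parcs (corona_K1 G))"
  proof (rule finite_subset)
    show "parcs (corona_K1 G) \<subseteq> (Inl ` pverts G \<union> Inr ` pverts G) \<times> (Inl ` pverts G \<union> Inr ` pverts G)"
      by (auto simp: corona_K1_def dest: in_arcsD1 in_arcsD2)
  qed (use pair_finite_verts in auto)
  have sym: "symmetric (with_proj (corona_K1 G))"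
    by (auto simp: symmetric_def corona_K1_def intro!: symI dest: arcs_symmetric)
  show ?thesis
    by unfold_locales
      (use fin sym pair_finite_verts in
        \<open>auto simp: corona_K1_def dest: in_arcsD1 in_arcsD2 no_loops'\<close>)
qed

lemma connected_corona_K1:
  assumes "pair_graph G" "Digraph_Component.connected (with_proj G)"
  shows "Digraph_Component.connected (with_proj (corona_K1 G))"
proof -
  interpret pair_graph G by fact
  interpret H: pair_graph "corona_K1 G" using pair_graph_corona_K1[OF assms(1)] .
  let ?H = "with_proj (corona_K1 G)"
  have base: "Inl u \<rightarrow>\<^sup>*\<^bsub>?H\<^esub> Inl v" if "u \<rightarrow>\<^sup>*\<^bsub>with_proj G\<^esub> v" for u v
    using that
  proof (induct rule: reachable_induct)
    case base
    then have "Inl u \<in> pverts (corona_K1 G)" by (auto simp: corona_K1_def)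
    then show ?case by (simp add: H.reachable_refl)
  next
    case (step x y)
    then have "Inl x \<rightarrow>\<^bsub>?H\<^esub> Inl y" by (auto simp: corona_K1_def)
    with step(3) show ?case by (rule wf_digraph.reachable_adj_trans[OF H.wf_digraph])
  qed
  have up: "Inl v \<rightarrow>\<^sup>*\<^bsub>?H\<^esub> Inr v" "Inr v \<rightarrow>\<^sup>*\<^bsub>?H\<^esub> Inl v" if "v \<in> pverts G" for v
    by (rule wf_digraph.reachable_adjI[OF H.wf_digraph], use that in \<open>simp add: corona_K1_def\<close>)+
  have "x \<rightarrow>\<^sup>*\<^bsub>?H\<^esub> y" if xy: "x \<in> pverts (corona_K1 G)" "y \<in> pverts (corona_K1 G)" for x y
  proof -
    obtain u v where uv: "u \<in> pverts G" "v \<in> pverts G" "x \<in> {Inl u, Inr u}" "y \<in> {Inl v, Inr v}"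
      using xy by (auto simp: corona_K1_def)
    have "Inl u \<rightarrow>\<^sup>*\<^bsub>?H\<^esub> Inl v"
      using assms(2) uv
      by (intro base) (auto simp: connected_iff_strongly_connected strongly_connected_def)
    with uv up show ?thesis by (blast intro: H.reachable_trans)
  qed
  moreover have "pverts (corona_K1 G) \<noteq> {}"
    using assms(2)
    by (auto simp: connected_iff_strongly_connected strongly_connected_def corona_K1_def)
  ultimately show ?thesis
    by (auto simp: H.connected_iff_strongly_connected strongly_connected_def)
qed

lemma packing_coloring_exists:
  assumes "pair_graph G"
  shows "\<exists>k c. packing_coloring G k c"
proof -
  interpret pair_graph G by fact
  obtain f where f: "bij_betw f (pverts G) {1..card (pverts G)}"
    using pair_finite_verts finite_same_card_bij
    by (metis card_atLeastAtMost diff_Suc_1 finite_atLeastAtMost)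
  then have "packing_coloring G (card (pverts G)) f"
    by (auto simp: packing_coloring_def bij_betw_def inj_on_def)
  then show ?thesis by blast
qed

end

theory Submission
  imports Defs
begin

text \<open>
  A corona over a caterpillar consists of a spine \<open>v\<^sub>0, v\<^sub>1, \<dots>\<close> whose vertices carry pendant
  vertices (their own corona partners) and pendant paths of length two (the leaves of the
  caterpillar followed by the partners of these leaves). The number of pendant paths at a spine
  vertex is unbounded, so they must be coloured uniformly. The partners of spine vertices and the
  leaves of the caterpillar form an independent set and get colour 1. The far ends of the pendant
  paths are at distance at least 4 from each other, so any mixture of the colours 2 and 3 is
  admissible among them.

  The spine is left with \<open>2, \<dots>, 7\<close>. A colour \<open>c\<close> covers at most every \<open>(c + 1)\<close>-st vertex of a
  path, so only one of 2 and 3 together with \<open>4, 5, 6, 7\<close> is too sparse for a long spine. Hence the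
  spine shares both 2 and 3 with the ends of the pendant paths.
  The word \<open>2 4 3 5 2 6 3 4 2 5 3 7\<close>, repeated periodically, does it: the colours 2 and 3 each
  have period four and stay two steps apart, and the remaining odd positions are filled with
  \<open>4 5 6 4 5 7\<close>. A pendant path at a spine vertex of colour 2 ends in 3, and all others end in 2.
  A far end at \<open>v\<^sub>i\<close> is \<open>\<bar>i - j\<bar> + 2\<close> away from \<open>v\<^sub>j\<close>; so a far end of colour 2 only has to avoid
  \<open>v\<^sub>i\<close> itself, and one of colour 3 has to avoid \<open>v\<^sub>i\<close> and its two spine neighbours.

  Every lower bound on a distance comes from a function that changes by at most one along each arc.
  The acyclicity of the caterpillar enters once: a chord of the spine would close a cycle, hence
  the index along the spine is such a function.
\<close>

section \<open>Lower bounds on distances\<close>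

text \<open>A function that is 1-Lipschitz along arcs grows along a walk by at most its length.\<close>

lemma lipschitz_imp_graph_dist_gt:
  fixes f :: "'a \<Rightarrow> int"
  assumes G: "pair_graph G" "Digraph_Component.connected (with_proj G)"
    and uv: "u \<in> pverts G" "v \<in> pverts G"
    and lip: "\<And>a b. (a, b) \<in> parcs G \<Longrightarrow> \<bar>f a - f b\<bar> \<le> 1"
    and gap: "int k < \<bar>f u - f v\<bar>"
  shows "graph_dist G u v > ereal (real k)"
proof -
  interpret pair_graph G by fact
  obtain p where p: "apath u p v" and d: "graph_dist G u v = ereal (real (length p))"
    using graph_dist_shortest_path[OF G uv] by metis
  have "\<bar>f x - f v\<bar> \<le> int (length q)" if "pcas x q v" "set q \<subseteq> parcs G" for x q
    using that
  proof (induct q arbitrary: x)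
    case (Cons e q)
    then have "\<bar>f x - f (snd e)\<bar> \<le> 1" "\<bar>f (snd e) - f v\<bar> \<le> int (length q)"
      using lip[of x "snd e"] by (cases e; auto)+
    then show ?case by simp
  qed simp
  then have "\<bar>f u - f v\<bar> \<le> int (length p)"
    using p by (auto simp: apath_def awalk_def)
  then show ?thesis using gap d by simp
qed

lemma non_adjacent_imp_graph_dist_gt_1:
  assumes G: "pair_graph G" "Digraph_Component.connected (with_proj G)"
    and uv: "u \<in> pverts G" "v \<in> pverts G" "u \<noteq> v" "(u, v) \<notin> parcs G"
  shows "graph_dist G u v > ereal (real 1)"
proof -
  interpret pair_graph G by fact
  show ?thesis
  proof (rule lipschitz_imp_graph_dist_gt[OF G uv(1,2)])
    \<comment> \<open>the distance from \<open>u\<close>, truncated at 2\<close>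
    let ?f = "\<lambda>x. if x = u then 0 else if (u, x) \<in> parcs G then 1 else 2 :: int"
    show "\<bar>?f a - ?f b\<bar> \<le> 1" if "(a, b) \<in> parcs G" for a b
      using that arcs_symmetric[of a b] by auto
    show "int 1 < \<bar>?f u - ?f v\<bar>" using uv(3,4) by auto
  qed
qed

section \<open>Positions along the spine\<close>

text \<open>
  All that the colouring needs to know about a caterpillar: a set of spine vertices and, for every
  vertex, the index of the spine vertex that it belongs to.
\<close>

locale caterpillar_layout = pair_graph T for T :: "'a pair_pre_digraph" +
  fixes spine :: "'a set" and pos :: "'a \<Rightarrow> nat"
  assumes conn: "Digraph_Component.connected (with_proj T)"
    and inj_pos: "inj_on pos spine"
    and spine_arc: "(u, v) \<in> parcs T \<Longrightarrow> u \<in> spine \<Longrightarrow> v \<in> spine \<Longrightarrow> \<bar>int (pos u) - int (pos v)\<bar> \<le> 1"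
    and leaf_arc: "(u, v) \<in> parcs T \<Longrightarrow> u \<notin> spine \<Longrightarrow> v \<in> spine \<and> pos u = pos v"

lemma pcas_vwalk_arcs:
  "q \<noteq> [] \<Longrightarrow> pcas (hd q) (vwalk_arcs q) (last q)"
  "q \<noteq> [] \<Longrightarrow> pawalk_verts (hd q) (vwalk_arcs q) = q"
  by (induct q rule: vwalk_arcs.induct) auto

text \<open>A chord of a path closes the segment between its ends to a cycle.\<close>

lemma undirected_tree_path_chord:
  assumes tree: "undirected_tree G" and p: "vpath p (with_proj G)"
    and ij: "i < j" "j < length p" and chord: "(p ! j, p ! i) \<in> parcs G"
  shows "j = Suc i"
proof (rule ccontr)
  assume "j \<noteq> Suc i"
  interpret pair_graph G using tree by (simp add: undirected_tree_def)
  define q where "q = drop i (take (Suc j) p)"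
  have len: "length q = Suc (j - i)" "3 \<le> length q"
    using ij \<open>j \<noteq> Suc i\<close> by (auto simp: q_def)
  then have ne: "q \<noteq> []" by auto
  have ends: "hd q = p ! i" "last q = p ! j"
    using ij len ne by (auto simp: q_def hd_drop_conv_nth last_conv_nth)
  have dist: "distinct q" using p by (auto simp: q_def vpath_def)
  have "p = (take i p @ q) @ drop (Suc j) p"
    using ij by (simp add: q_def)
      (metis append_take_drop_id le_SucI less_imp_le_nat min_absorb1 append.assoc take_take)
  then have "vwalk q (with_proj G)"
    using p ne vwalkI_append_l vwalkI_append_r unfolding vpath_def
    by (metis append_is_Nil_conv)
  then have q: "set q \<subseteq> pverts G" "set (vwalk_arcs q) \<subseteq> parcs G" by (auto simp: vwalk_def)
  let ?c = "vwalk_arcs (last q # q)"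
  have c: "?c = (last q, hd q) # vwalk_arcs q" using ne by simp
  have "awalk (last q) ?c (last q)"
    using q ne chord ends pcas_vwalk_arcs(1)[OF ne] in_arcsD1[OF chord] unfolding awalk_def c by auto
  moreover have "distinct (tl (pawalk_verts (last q) ?c))"
    using dist pcas_vwalk_arcs(2)[OF ne] unfolding c by simp
  ultimately have "cycle ?c" unfolding cycle_def c by auto
  moreover have "3 \<le> length ?c"
    using len(2) vwalk_length_simp[of "last q # q"] unfolding vwalk_length_def by simp
  ultimately show False using tree unfolding undirected_tree_def by blast
qed

lemma (in pair_graph) low_out_degree_unique_neighbour:
  assumes "\<not> 2 \<le> out_degree (with_proj G) v" "(v, a) \<in> parcs G" "(v, b) \<in> parcs G"
  shows "a = b"
proof (rule ccontr)
  assume "a \<noteq> b"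
  have "card {(v, a), (v, b)} \<le> card (out_arcs (with_proj G) v)"
    by (rule card_mono) (use assms(2,3) in \<open>auto simp: finite_out_arcs\<close>)
  then show False using \<open>a \<noteq> b\<close> assms(1) by (simp add: out_degree_def)
qed

text \<open>
  A vertex off the central path has degree at most one, so by connectedness its only neighbour lies
  on the path; it takes the index of that neighbour.
\<close>

lemma caterpillar_has_layout:
  assumes "caterpillar T"
  obtains spine pos where "caterpillar_layout T spine pos"
proof -
  obtain p where tree: "undirected_tree T" and p: "vpath p (with_proj T)"
    and deg: "{v \<in> pverts T. 2 \<le> out_degree (with_proj T) v} \<subseteq> set p"
    using assms by (auto simp: caterpillar_def)
  interpret pair_graph T using tree by (simp add: undirected_tree_def)
  have conn: "Digraph_Component.connected (with_proj T)"
    using tree by (simp add: undirected_tree_def)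
  have pne: "p \<noteq> []" and psub: "set p \<subseteq> pverts T" and pd: "distinct p"
    using p by (auto simp: vpath_def vwalk_def)
  have unique: "a = b" if "v \<notin> set p" "(v, a) \<in> parcs T" "(v, b) \<in> parcs T" for v a b
    using low_out_degree_unique_neighbour[OF _ that(2,3)] that deg in_arcsD1 by blast
  have near: "x \<in> set p \<or> (\<exists>z\<in>set p. (x, z) \<in> parcs T)" if "hd p \<rightarrow>\<^sup>*\<^bsub>with_proj T\<^esub> x" for x
    using that
  proof (induct rule: reachable_induct)
    case base
    then show ?case using pne by simp
  next
    case (step x y)
    then have xy: "(x, y) \<in> parcs T" "(y, x) \<in> parcs T" using arcs_symmetric by auto
    with step(3) show ?case using unique by blast
  qed
  have leaf: "v \<in> set p" if uv: "(u, v) \<in> parcs T" "u \<notin> set p" for u v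
  proof -
    have "hd p \<rightarrow>\<^sup>*\<^bsub>with_proj T\<^esub> u"
      using conn in_arcsD1[OF uv(1)] psub hd_in_set[OF pne]
      by (auto simp: connected_iff_strongly_connected strongly_connected_def)
    then show ?thesis using near uv unique by blast
  qed
  define index where "index v = (THE i. i < length p \<and> p ! i = v)" for v
  have index: "index v < length p" "p ! index v = v" if "v \<in> set p" for v
  proof -
    have "\<exists>!i. i < length p \<and> p ! i = v"
      using that pd by (auto simp: in_set_conv_nth nth_eq_iff_index_eq)
    then have "index v < length p \<and> p ! index v = v"
      unfolding index_def by (rule theI')
    then show "index v < length p" "p ! index v = v" by auto
  qed
  define pos where "pos v = index (if v \<in> set p then v else (SOME w. (v, w) \<in> parcs T))" for v
  have "caterpillar_layout T (set p) pos"
  proof unfold_locales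
    show "Digraph_Component.connected (with_proj T)" by (rule conn)
    show "inj_on pos (set p)"
      by (rule inj_onI) (metis index(2) pos_def)
    show "\<bar>int (pos u) - int (pos v)\<bar> \<le> 1"
      if uv: "(u, v) \<in> parcs T" "u \<in> set p" "v \<in> set p" for u v
    proof -
      have "index v = Suc (index u)" if "index u < index v"
        using undirected_tree_path_chord[OF tree p that] index uv arcs_symmetric by auto
      moreover have "index u = Suc (index v)" if "index v < index u"
        using undirected_tree_path_chord[OF tree p that] index uv by auto
      ultimately show ?thesis
        using uv by (cases "index u" "index v" rule: linorder_cases) (auto simp: pos_def)
    qed
    show "v \<in> set p \<and> pos u = pos v" if uv: "(u, v) \<in> parcs T" "u \<notin> set p" for u v
    proof -
      have "(SOME w. (u, w) \<in> parcs T) = v"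
        using uv unique by (metis someI)
      then show ?thesis using leaf[OF uv] uv(2) by (simp add: pos_def)
    qed
  qed
  then show thesis by (rule that)
qed

section \<open>The periodic colouring of the spine\<close>

definition spine_colour :: "nat \<Rightarrow> nat" where
  "spine_colour i = [2, 4, 3, 5, 2, 6, 3, 4, 2, 5, 3, 7] ! (i mod 12)"

text \<open>By periodicity, only gaps up to 7 from the twelve residues have to be inspected.\<close>

lemma spine_colour_residue_gap:
  "\<forall>a\<in>set [0..<12]. \<forall>d\<in>set [1..<8]. spine_colour (a + d) = spine_colour a \<longrightarrow> spine_colour a < d"
  unfolding spine_colour_def by code_simp

lemma spine_colour_cases:
  "spine_colour i \<in> {2..7}"
  "spine_colour i = 2 \<longleftrightarrow> i mod 4 = 0"
  "spine_colour i = 3 \<longleftrightarrow> i mod 4 = 2"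
proof -
  have "\<forall>a\<in>set [0..<12]. spine_colour a \<in> set [2..<8]
      \<and> (spine_colour a = 2 \<longleftrightarrow> a mod 4 = 0) \<and> (spine_colour a = 3 \<longleftrightarrow> a mod 4 = 2)"
    unfolding spine_colour_def by code_simp
  from bspec[OF this, of "i mod 12"]
  have "spine_colour (i mod 12) \<in> {2..7}
      \<and> (spine_colour (i mod 12) = 2 \<longleftrightarrow> i mod 4 = 0)
      \<and> (spine_colour (i mod 12) = 3 \<longleftrightarrow> i mod 4 = 2)"
    by (auto simp: mod_mod_cancel)
  moreover have "spine_colour (i mod 12) = spine_colour i" by (simp add: spine_colour_def)
  ultimately show "spine_colour i \<in> {2..7}" "spine_colour i = 2 \<longleftrightarrow> i mod 4 = 0"
    "spine_colour i = 3 \<longleftrightarrow> i mod 4 = 2" by auto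
qed

lemma spine_colour_gap:
  assumes "spine_colour i = spine_colour j" "i \<noteq> j"
  shows "int (spine_colour i) < \<bar>int i - int j\<bar>"
proof -
  have "spine_colour i < j - i" if ij: "i < j" "spine_colour i = spine_colour j" for i j
  proof (cases "j - i < 8")
    case True
    have "(i mod 12 + (j - i)) mod 12 = j mod 12"
      using ij(1) mod_add_left_eq[of i 12 "j - i"] by simp
    then have mod: "spine_colour (i mod 12) = spine_colour i"
      "spine_colour (i mod 12 + (j - i)) = spine_colour j"
      by (simp_all add: spine_colour_def)
    have "i mod 12 \<in> set [0..<12]" "j - i \<in> set [1..<8]" using True ij(1) by auto
    with spine_colour_residue_gap
    have "spine_colour (i mod 12 + (j - i)) = spine_colour (i mod 12)
        \<longrightarrow> spine_colour (i mod 12) < j - i" by blast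
    then show ?thesis using mod ij(2) by simp
  qed (use spine_colour_cases(1)[of i] in auto)
  from this[of i j] this[of j i] show ?thesis using assms by (cases "i < j") auto
qed

section \<open>Colouring the corona\<close>

context caterpillar_layout
begin

fun depth :: "'a + 'a \<Rightarrow> int" where
  "depth (Inl v) = (if v \<in> spine then 0 else 1)"
| "depth (Inr v) = (if v \<in> spine then 1 else 2)"

fun anchor :: "'a + 'a \<Rightarrow> nat" where
  "anchor (Inl v) = pos v"
| "anchor (Inr v) = pos v"

text \<open>The distance in the corona to the spine vertex at position \<open>i\<close>, if there is one.\<close>

definition spine_dist :: "nat \<Rightarrow> 'a + 'a \<Rightarrow> int" where
  "spine_dist i x = \<bar>int (anchor x) - int i\<bar> + depth x"

text \<open>Negating the depth on the pendant path of \<open>l\<close> separates it from all other pendant paths.\<close>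

definition signed_depth :: "'a \<Rightarrow> 'a + 'a \<Rightarrow> int" where
  "signed_depth l x = (if x = Inl l \<or> x = Inr l then - depth x else depth x)"

fun colour :: "'a + 'a \<Rightarrow> nat" where
  "colour (Inl v) = (if v \<in> spine then spine_colour (pos v) else 1)"
| "colour (Inr v) = (if v \<in> spine then 1 else if pos v mod 4 = 0 then 3 else 2)"

lemma corona_arc_cases:
  assumes "(a, b) \<in> parcs (corona_K1 T)"
  obtains u v where "a = Inl u" "b = Inl v" "(u, v) \<in> parcs T" "(v, u) \<in> parcs T"
  | v where "a = Inl v" "b = Inr v"
  | v where "a = Inr v" "b = Inl v"
  using assms arcs_symmetric by (auto simp: corona_K1_def)

lemma spine_dist_lipschitz:
  assumes "(a, b) \<in> parcs (corona_K1 T)"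
  shows "\<bar>spine_dist i a - spine_dist i b\<bar> \<le> 1"
  using assms
proof (cases rule: corona_arc_cases)
  case (1 u v)
  then show ?thesis
    using spine_arc[of u v] leaf_arc[of u v] leaf_arc[of v u]
    by (auto simp: spine_dist_def)
qed (auto simp: spine_dist_def)

lemma signed_depth_lipschitz:
  assumes "l \<notin> spine" "(a, b) \<in> parcs (corona_K1 T)"
  shows "\<bar>signed_depth l a - signed_depth l b\<bar> \<le> 1"
  using assms(2)
proof (cases rule: corona_arc_cases)
  case (1 u v)
  then show ?thesis
    using assms(1) leaf_arc[of u v] leaf_arc[of v u]
    by (auto simp: signed_depth_def)
qed (use assms(1) in \<open>auto simp: signed_depth_def\<close>)

lemmas corona_dist_gt =
  lipschitz_imp_graph_dist_gt[OF pair_graph_corona_K1[OF pair_graph]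
    connected_corona_K1[OF pair_graph conn]]

text \<open>
  Class 1 is independent. Every other class consists of spine vertices and far ends of pendant
  paths: \<^const>\<open>spine_dist\<close> separates a spine vertex from either kind, and
  \<^const>\<open>signed_depth\<close> separates two far ends.
\<close>

lemma packing_coloring_colour: "packing_coloring (corona_K1 T) 7 colour"
proof -
  let ?H = "corona_K1 T"
  have range: "colour x \<in> {1..7}" for x
  proof (cases x)
    case (Inl v)
    then show ?thesis using spine_colour_cases(1)[of "pos v"] by auto
  qed auto
  have "graph_dist ?H x y > ereal (real (colour x))"
    if xy: "x \<in> pverts ?H" "y \<in> pverts ?H" "x \<noteq> y" "colour x = colour y" for x y
  proof (cases "colour x = 1")
    case True
    then have one: "colour x = 1" "colour y = 1" using xy(4) by simp_all
    have spine_not_1: "colour (Inl v) \<noteq> 1" if "v \<in> spine" for v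
      using that spine_colour_cases(1)[of "pos v"] by auto
    have end_not_1: "colour (Inr l) \<noteq> 1" if "l \<notin> spine" for l
      using that by simp
    have "(x, y) \<notin> parcs ?H"
    proof
      assume "(x, y) \<in> parcs ?H"
      then show False
      proof (cases rule: corona_arc_cases)
        case (1 u v)
        then have "u \<notin> spine" "v \<notin> spine" using one spine_not_1 by metis+
        then show False using 1(3) leaf_arc by blast
      next
        case (2 v)
        then show False using one spine_not_1 end_not_1 by metis
      next
        case (3 v)
        then show False using one spine_not_1 end_not_1 by metis
      qed
    qed
    then show ?thesis
      using non_adjacent_imp_graph_dist_gt_1[OF pair_graph_corona_K1[OF pair_graph]
          connected_corona_K1[OF pair_graph conn] xy(1-3)] True by simp
  next
    case False
    have spine_or_end: "(\<exists>v\<in>spine. z = Inl v) \<or> (\<exists>l. l \<notin> spine \<and> z = Inr l)"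
      if "colour z \<noteq> 1" for z
      using that by (cases z) (auto split: if_splits)
    have spine_end: "int (colour (Inl v)) < spine_dist (pos v) (Inr l)"
      if "v \<in> spine" "l \<notin> spine" "colour (Inl v) = colour (Inr l)" for v l
    proof -
      \<comment> \<open>for colour 3 the positions are 2 and 0 modulo 4, hence two steps apart\<close>
      have "pos l mod 4 = 0 \<and> pos v mod 4 = 2 \<and> colour (Inl v) = 3
          \<or> pos l \<noteq> pos v \<and> colour (Inl v) = 2"
        using that spine_colour_cases(2,3)[of "pos v"] by (auto split: if_splits)
      then show ?thesis
      proof
        assume a: "pos l mod 4 = 0 \<and> pos v mod 4 = 2 \<and> colour (Inl v) = 3"
        then have "pos l mod 4 = 0" "pos v mod 4 = 2" by simp_all
        then have "pos l \<noteq> pos v" "pos l \<noteq> Suc (pos v)" "pos v \<noteq> Suc (pos l)"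
          by presburger+
        then have "\<bar>int (pos l) - int (pos v)\<bar> \<ge> 2" by linarith
        then show ?thesis using a that(2) by (simp add: spine_dist_def)
      qed (use that(2) in \<open>auto simp: spine_dist_def\<close>)
    qed
    have dist_spine: "spine_dist (pos v) (Inl v) = 0" if "v \<in> spine" for v
      using that by (simp add: spine_dist_def)
    have "colour y \<noteq> 1" using False xy(4) by simp
    from spine_or_end[OF False] spine_or_end[OF this]
    consider
        (spine) u v where "u \<in> spine" "v \<in> spine" "x = Inl u" "y = Inl v"
      | (left) u l where "u \<in> spine" "l \<notin> spine" "x = Inl u" "y = Inr l"
      | (right) l v where "l \<notin> spine" "v \<in> spine" "x = Inr l" "y = Inl v"
      | (ends) l m where "l \<notin> spine" "m \<notin> spine" "x = Inr l" "y = Inr m"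
      by blast
    then show ?thesis
    proof cases
      case spine
      then have "pos u \<noteq> pos v" using inj_pos xy(3) by (auto dest: inj_onD)
      then have "int (colour x) < \<bar>spine_dist (pos u) x - spine_dist (pos u) y\<bar>"
        using spine xy(4) spine_colour_gap[of "pos u" "pos v"] by (simp add: spine_dist_def)
      then show ?thesis
        using corona_dist_gt[OF xy(1,2), of "spine_dist (pos u)"] spine_dist_lipschitz by blast
    next
      case left
      then have "int (colour x) < \<bar>spine_dist (pos u) x - spine_dist (pos u) y\<bar>"
        using spine_end[of u l] xy(4) dist_spine[of u] by simp
      then show ?thesis
        using corona_dist_gt[OF xy(1,2), of "spine_dist (pos u)"] spine_dist_lipschitz by blast
    next
      case right
      then have "int (colour x) < \<bar>spine_dist (pos v) x - spine_dist (pos v) y\<bar>"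
        using spine_end[of v l] xy(4) dist_spine[of v] by simp
      then show ?thesis
        using corona_dist_gt[OF xy(1,2), of "spine_dist (pos v)"] spine_dist_lipschitz by blast
    next
      case ends
      \<comment> \<open>two far ends are four steps apart, even at the same spine vertex\<close>
      then have "int (colour x) < \<bar>signed_depth l x - signed_depth l y\<bar>"
        using xy(3) by (auto simp: signed_depth_def)
      then show ?thesis
        using corona_dist_gt[OF xy(1,2), of "signed_depth l"] signed_depth_lipschitz[OF ends(1)]
        by blast
    qed
  qed
  then show ?thesis using range unfolding packing_coloring_def by (metis Pi_I)
qed

end

theorem proposition4:
  fixes T :: "'a pair_pre_digraph"
  assumes "caterpillar T"
  shows "packing_chromatic_number (corona_K1 T) \<le> 7"
proof -
  obtain spine pos where "caterpillar_layout T spine pos"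
    using caterpillar_has_layout[OF assms] .
  then have "\<exists>c. packing_coloring (corona_K1 T) 7 c"
    using caterpillar_layout.packing_coloring_colour by blast
  then show ?thesis unfolding packing_chromatic_number_def by (rule Least_le)
qed

end
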